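(* Let $d,n\ge2$ be integers. For every $\mathbf{X}\in\mathbb{B}^{d\times n}_{\neq0}$, with $\alpha=\|\mathbf{X}\|_0$, $$\frac{1}{R(\alpha,n,d)}\le\frac{C_P(\mathbf{X})}{C_D(\mathbf{X})}\le R(\alpha,d,n).$$ Moreover, these bounds are tight: for every integer $\alpha$ with $\max\{d,n\}\le\alpha\le dn$, each of the two inequalities holds with equality for some $\mathbf{X}\in\mathbb{B}^{d\times n}_{\neq0}$ with $\|\mathbf{X}\|_0=\alpha$.
   Context: $\mathbb{B}^{d\times n}_{\neq0}$ is the set of $d\times n$ matrices with all entries in $\{-1,0,1\}$ and with no zero row and no zero column. $\|\cdot\|_0$ denotes the number of nonzero entries, $\|\cdot\|$ the Euclidean norm, $\mathbf{X}_{i:}$ and $\mathbf{X}_{:j}$ the $i$-th row and $j$-th column of $\mathbf{X}$, and $$C_P(\mathbf{X})=\sum_{i=1}^d\|\mathbf{X}_{i:}\|_0\|\mathbf{X}_{i:}\|^2,\qquad C_D(\mathbf{X})=\sum_{j=1}^n\|\mathbf{X}_{:j}\|_0\|\mathbf{X}_{:j}\|^2.$$ For an integer $a$ and a positive integer $b$ let $\bar a_b=b\lfloor a/b\rfloor$. Define $$L(\alpha,n)=\frac1n\left(\bar\alpha_n^2+(\alpha-\bar\alpha_n)(2\bar\alpha_n+n)\right),$$ $$U(\alpha,d,n)=(d+1)\overline{(\alpha-n)}_{d-1}+n-1+\left(\alpha-n+1-\overline{(\alpha-n)}_{d-1}\right)^2,$$ $$R(\alpha,d,n)=\frac{U(\alpha,n,d)}{L(\alpha,n)}.$$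 The functions are used with permuted arguments; thus $U(\alpha,n,d)=(n+1)\overline{(\alpha-d)}_{n-1}+d-1+\left(\alpha-d+1-\overline{(\alpha-d)}_{n-1}\right)^2$ and $R(\alpha,n,d)=U(\alpha,d,n)/L(\alpha,d)$. *)

theory Defs
  imports "HOL-Analysis.Analysis"
begin

text \<open>
  A \<open>d \<times> n\<close> matrix has type \<^typ>\<open>real ^ 'n ^ 'd\<close>, with \<open>d = CARD('d)\<close> rows and \<open>n = CARD('n)\<close> columns.
\<close>

definition l0_norm :: "real ^ 'n \<Rightarrow> nat" where
  "l0_norm x = card {i. x $ i \<noteq> 0}"

definition mat_l0_norm :: "real ^ 'n ^ 'd \<Rightarrow> nat" where
  "mat_l0_norm X = card {(i, j). X $ i $ j \<noteq> 0}"

definition ternary_nonzero :: "(real ^ 'n ^ 'd) set" where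
  "ternary_nonzero = {X. (\<forall>i j. X $ i $ j \<in> {-1, 0, 1}) \<and>
     (\<forall>i. row i X \<noteq> 0) \<and> (\<forall>j. column j X \<noteq> 0)}"

definition C_P :: "real ^ 'n ^ 'd \<Rightarrow> real" where
  "C_P X = (\<Sum>i\<in>UNIV. real (l0_norm (row i X)) * (norm (row i X))\<^sup>2)"

definition C_D :: "real ^ 'n ^ 'd \<Rightarrow> real" where
  "C_D X = (\<Sum>j\<in>UNIV. real (l0_norm (column j X)) * (norm (column j X))\<^sup>2)"

definition round_down :: "int \<Rightarrow> int \<Rightarrow> int" where
  "round_down a b = b * \<lfloor>real_of_int a / real_of_int b\<rfloor>"

definition lower_L :: "int \<Rightarrow> int \<Rightarrow> real" where
  "lower_L \<alpha> n = 1 / real_of_int n * real_of_int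
     ((round_down \<alpha> n)\<^sup>2 + (\<alpha> - round_down \<alpha> n) * (2 * round_down \<alpha> n + n))"

definition upper_U :: "int \<Rightarrow> int \<Rightarrow> int \<Rightarrow> real" where
  "upper_U \<alpha> d n = real_of_int
     ((d + 1) * round_down (\<alpha> - n) (d - 1) + n - 1
      + (\<alpha> - n + 1 - round_down (\<alpha> - n) (d - 1))\<^sup>2)"

text \<open>The dimensions are swapped in the numerator: \<open>U(\<alpha>, n, d)\<close> over \<open>L(\<alpha>, n)\<close>.\<close>

definition ratio_R :: "int \<Rightarrow> int \<Rightarrow> int \<Rightarrow> real" where
  "ratio_R \<alpha> d n = upper_U \<alpha> n d / lower_L \<alpha> n"

end

theory Submission imports Defs begin

text \<open>
  For a ternary matrix, \<open>C_P\<close> and \<open>C_D\<close> are the sums of the squared row counts and of the squared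
  column counts of nonzero entries. For a fixed total \<open>\<alpha>\<close>, the sum of \<open>d\<close> squares of numbers in
  \<open>[1, n]\<close> is largest when as many of them as possible are \<open>n\<close> and all but one of the others are
  \<open>1\<close>; this gives \<open>U(\<alpha>, n, d)\<close>. The sum of \<open>n\<close> squares of integers is least when they differ by at
  most one; this gives \<open>L(\<alpha>, n)\<close>. Both extremes are attained by one matrix: prescribe the extremal
  row counts and fill the rows one after the other, moving cyclically through the columns. The
  other inequality follows by transposition.
\<close>

subsection \<open>Sums of squares with a prescribed sum\<close>

text \<open>For m > 0 this is the largest sum of squares of naturals in [0, m] with sum T and no
  limit on their number: T div m of them equal m, one is the remainder. It is applied with m = n - 1
  to row counts reduced by 1.\<close>

definition extremal_squares :: "nat \<Rightarrow> nat \<Rightarrow> nat" where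
  "extremal_squares m T = m\<^sup>2 * (T div m) + (T mod m)\<^sup>2"

text \<open>Only y and the remainder s = T mod m interact. If y + s < m, merging them gains 2ys.
  Otherwise they become m and u = y + s - m, which have the same sum but lie at least as far
  apart.\<close>

lemma extremal_squares_superadditive:
  assumes "y \<le> m" and "0 < m"
  shows "y\<^sup>2 + extremal_squares m T \<le> extremal_squares m (y + T)"
proof -
  define q s where "q = T div m" and "s = T mod m"
  have T: "T = m * q + s" and s: "s < m"
    using assms by (auto simp: q_def s_def)
  have E: "extremal_squares m T = m\<^sup>2 * q + s\<^sup>2"
    by (simp add: extremal_squares_def q_def s_def)
  show ?thesis
  proof (cases "y + s < m")
    case True
    have "(y + T) div m = q" "(y + T) mod m = y + s"
      using True by (auto simp: T add.left_commute[of y])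
    then have "extremal_squares m (y + T) = m\<^sup>2 * q + (y + s)\<^sup>2"
      by (simp add: extremal_squares_def)
    then show ?thesis
      by (simp add: E power2_sum)
  next
    case False
    define u where "u = y + s - m"
    have u: "u < m" "y + s = m + u"
      using False s assms by (auto simp: u_def)
    have yT: "y + T = m * (q + 1) + u"
      using u(2) by (simp add: T)
    have "(m * k + u) div m = k" "(m * k + u) mod m = u" for k
      using u(1) by simp_all
    then have "(y + T) div m = q + 1" "(y + T) mod m = u"
      by (simp_all only: yT)
    then have F: "extremal_squares m (y + T) = m\<^sup>2 * (q + 1) + u\<^sup>2"
      by (simp add: extremal_squares_def)
    \<comment> \<open>Over the integers the gain m^2 + u^2 - y^2 - s^2 factors as 2(m - s)(m - y),
      and both factors are nonnegative.\<close>
    have int_u: "int u = int y + int s - int m"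
      using u by simp
    have "0 \<le> 2 * (int m - int s) * (int m - int y)"
      using s assms by simp
    also have "\<dots> = (int m)\<^sup>2 + (int u)\<^sup>2 - ((int y)\<^sup>2 + (int s)\<^sup>2)"
      unfolding int_u by (simp add: power2_eq_square algebra_simps)
    finally have "(int y)\<^sup>2 + (int s)\<^sup>2 \<le> (int m)\<^sup>2 + (int u)\<^sup>2"
      by simp
    then have "int (y\<^sup>2 + s\<^sup>2) \<le> int (m\<^sup>2 + u\<^sup>2)"
      by simp
    then have "y\<^sup>2 + s\<^sup>2 \<le> m\<^sup>2 + u\<^sup>2"
      by (simp only: of_nat_le_iff)
    then show ?thesis
      by (simp add: E F)
  qed
qed

lemma sum_squares_le_extremal:
  fixes y :: "'a \<Rightarrow> nat"
  assumes "finite I" and "0 < m" and "\<And>i. i \<in> I \<Longrightarrow> y i \<le> m"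
  shows "(\<Sum>i\<in>I. (y i)\<^sup>2) \<le> extremal_squares m (\<Sum>i\<in>I. y i)"
  using assms(1,3)
proof (induction I rule: finite_induct)
  case empty
  show ?case by (simp add: extremal_squares_def)
next
  case (insert x I)
  then have "(\<Sum>i\<in>insert x I. (y i)\<^sup>2) \<le> (y x)\<^sup>2 + extremal_squares m (\<Sum>i\<in>I. y i)"
    by simp
  also have "\<dots> \<le> extremal_squares m (y x + (\<Sum>i\<in>I. y i))"
    using insert.prems assms(2) by (intro extremal_squares_superadditive) auto
  finally show ?case
    using insert.hyps by simp
qed

text \<open>Greedy choice: each new index takes min T m. Either this exhausts T, or a full value m
  lowers T div m by 1 and keeps T mod m. The bound on T makes the indices suffice.\<close>

lemma sum_squares_extremal_attained:
  assumes "finite I" and "0 < m" and "T \<le> card I * m"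
  shows "\<exists>y :: 'a \<Rightarrow> nat. (\<forall>i. y i \<le> m) \<and> (\<Sum>i\<in>I. y i) = T \<and>
           (\<Sum>i\<in>I. (y i)\<^sup>2) = extremal_squares m T"
  using assms(1,3)
proof (induction I arbitrary: T rule: finite_induct)
  case empty
  then show ?case by (auto simp: extremal_squares_def)
next
  case (insert x I)
  define v where "v = min T m"
  have "T - v \<le> card I * m"
    using insert by (auto simp: v_def min_def)
  then obtain y where y: "\<forall>i. y i \<le> m" "(\<Sum>i\<in>I. y i) = T - v"
      "(\<Sum>i\<in>I. (y i)\<^sup>2) = extremal_squares m (T - v)"
    using insert.IH by blast
  have "v\<^sup>2 + extremal_squares m (T - v) = extremal_squares m T"
  proof (cases "T < m")
    case True
    then show ?thesis by (simp add: v_def extremal_squares_def)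
  next
    case False
    then show ?thesis
      using assms(2) by (simp add: v_def extremal_squares_def le_div_geq le_mod_geq)
  qed
  moreover have "(\<Sum>i\<in>I. (y(x := v)) i) = (\<Sum>i\<in>I. y i)"
      "(\<Sum>i\<in>I. ((y(x := v)) i)\<^sup>2) = (\<Sum>i\<in>I. (y i)\<^sup>2)"
    using insert.hyps by (auto intro!: sum.cong)
  ultimately have "(\<forall>i. (y(x := v)) i \<le> m) \<and> (\<Sum>i\<in>insert x I. (y(x := v)) i) = T \<and>
      (\<Sum>i\<in>insert x I. ((y(x := v)) i)\<^sup>2) = extremal_squares m T"
    using insert.hyps y by (simp add: v_def)
  then show ?case by blast
qed

text \<open>The difference of the two sides below is the sum of the terms \<open>(x - q)(x - (q + 1))\<close>.\<close>

lemma sum_squares_balanced: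
  fixes x :: "'a \<Rightarrow> int" and q :: int
  shows "(\<Sum>i\<in>I. (x i)\<^sup>2) - ((2 * q + 1) * (\<Sum>i\<in>I. x i) - int (card I) * (q * (q + 1)))
    = (\<Sum>i\<in>I. (x i - q) * (x i - (q + 1)))"
proof -
  have "(\<Sum>i\<in>I. (x i - q) * (x i - (q + 1)))
      = (\<Sum>i\<in>I. (x i)\<^sup>2 - (2 * q + 1) * x i + q * (q + 1))"
    by (intro sum.cong refl) (simp add: power2_eq_square algebra_simps)
  then show ?thesis
    by (simp add: sum.distrib sum_subtractf sum_distrib_left)
qed

subsection \<open>The bounds in terms of division with remainder\<close>

lemma round_down_eq: "round_down a b = b * (a div b)"
  by (simp add: round_down_def floor_divide_of_int_eq)

text \<open>With q = a div n the integer factor in \<open>lower_L\<close> is a multiple of n. The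
  quotient is exactly what \<open>sum_squares_balanced\<close> subtracts from the sum of squares of
  n integers with sum a.\<close>

lemma lower_L_eq:
  assumes "0 < n"
  shows "lower_L a n =
    real_of_int ((2 * (a div n) + 1) * a - n * ((a div n) * (a div n + 1)))"
proof -
  define q where "q = a div n"
  define k where "k = (2 * q + 1) * a - n * (q * (q + 1))"
  have "lower_L a n = 1 / real_of_int n *
      real_of_int ((n * q)\<^sup>2 + (a - n * q) * (2 * (n * q) + n))"
    by (simp only: lower_L_def round_down_eq q_def)
  also have "(n * q)\<^sup>2 + (a - n * q) * (2 * (n * q) + n) = n * k"
    by (simp add: k_def power2_eq_square algebra_simps)
  also have "1 / real_of_int n * real_of_int (n * k) = real_of_int k"
    using assms by simp
  finally show ?thesis
    by (simp only: k_def q_def)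
qed

text \<open>For a = nq + s the value is nq^2 + (2q + 1)s, where q and s are nonnegative and not both
  0.\<close>

lemma lower_L_pos:
  assumes "0 < n" and "0 < a"
  shows "0 < lower_L a n"
proof -
  define q s where "q = a div n" and "s = a mod n"
  have a: "a = n * q + s" and nonneg: "0 \<le> q" "0 \<le> s"
    using assms by (simp_all add: q_def s_def pos_imp_zdiv_nonneg_iff)
  have "(2 * q + 1) * a - n * (q * (q + 1)) = n * (q * q) + (2 * q + 1) * s"
    unfolding a by (simp add: algebra_simps)
  moreover have "0 < n * (q * q) + (2 * q + 1) * s"
  proof (cases "q = 0")
    case True
    then show ?thesis using a assms by simp
  next
    case False
    then show ?thesis
      using nonneg assms by (intro add_pos_nonneg) auto
  qed
  ultimately show ?thesis
    by (simp only: lower_L_eq[OF assms(1)] of_int_0_less_iff flip: q_def)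
qed

text \<open>T is what remains of \<alpha> after each of the d rows gets one entry. If the row counts
  are y + 1 with the y summing to T, the sum of their squares exceeds that of the y by 2T + d. The
  last square in \<open>upper_U\<close> is (T mod (n - 1) + 1)^2.\<close>

lemma upper_U_eq:
  assumes "2 \<le> n"
  shows "upper_U (int T + int d) (int n) (int d) =
    real (extremal_squares (n - 1) T + 2 * T + d)"
proof -
  define m where "m = n - 1"
  define q s where "q = T div m" and "s = T mod m"
  have T: "int T = int m * int q + int s"
    unfolding q_def s_def by (metis mult_div_mod_eq of_nat_add of_nat_mult)
  have n: "int n = int m + 1"
    using assms by (simp add: m_def)
  have r: "round_down (int T) (int m) = int m * int q"
    by (simp add: round_down_eq q_def zdiv_int)
  have "upper_U (int T + int d) (int n) (int d) = real_of_int
      ((int m + 2) * (int m * int q) + int d - 1 + (int T + 1 - int m * int q)\<^sup>2)"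
    unfolding upper_U_def n by (simp add: r)
  also have "(int m + 2) * (int m * int q) + int d - 1 + (int T + 1 - int m * int q)\<^sup>2
      = int (m\<^sup>2 * q + s\<^sup>2 + 2 * T + d)"
    by (simp add: T power2_eq_square algebra_simps)
  finally show ?thesis
    by (simp only: extremal_squares_def m_def q_def s_def of_int_of_nat_eq)
qed

subsection \<open>Counting nonzero entries\<close>

text \<open>Nonzero entries have square 1. Hence every summand of \<open>C_P\<close> and
  \<open>C_D\<close> of a ternary matrix is the square of a count.\<close>

lemma norm_square_ternary:
  fixes x :: "real ^ 'n"
  assumes "\<And>j. x $ j \<in> {-1, 0, 1}"
  shows "(norm x)\<^sup>2 = real (l0_norm x)"
proof -
  have "(norm x)\<^sup>2 = (\<Sum>j\<in>UNIV. (x $ j)\<^sup>2)"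
    by (simp add: norm_vec_def L2_set_def sum_nonneg)
  also have "\<dots> = (\<Sum>j\<in>UNIV. if x $ j \<noteq> 0 then 1 else 0)"
    using assms by (intro sum.cong refl) (auto simp: power2_eq_1_iff)
  also have "\<dots> = real (l0_norm x)"
    by (simp add: l0_norm_def flip: sum.inter_filter)
  finally show ?thesis .
qed

lemma l0_norm_le: "l0_norm (x :: real ^ 'n) \<le> CARD('n)"
  unfolding l0_norm_def by (rule card_mono) auto

lemma l0_norm_pos: "x \<noteq> 0 \<Longrightarrow> 0 < l0_norm x"
  by (auto simp: l0_norm_def card_gt_0_iff vec_eq_iff)

lemma mat_l0_norm_rows: "mat_l0_norm X = (\<Sum>i\<in>UNIV. l0_norm (row i X))"
proof -
  have "{(i, j). X $ i $ j \<noteq> 0} = (SIGMA i:UNIV. {j. X $ i $ j \<noteq> 0})"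
    by auto
  then show ?thesis
    by (simp add: mat_l0_norm_def l0_norm_def row_def)
qed

lemma mat_l0_norm_transpose: "mat_l0_norm (transpose X) = mat_l0_norm X"
proof -
  have "{(i, j). transpose X $ i $ j \<noteq> 0} = prod.swap ` {(i, j). X $ i $ j \<noteq> 0}"
    by (auto simp: transpose_def image_iff)
  then show ?thesis
    by (simp add: mat_l0_norm_def card_image)
qed

lemma mat_l0_norm_columns: "mat_l0_norm X = (\<Sum>j\<in>UNIV. l0_norm (column j X))"
  using mat_l0_norm_rows[of "transpose X"] by (simp add: mat_l0_norm_transpose)

lemma ternary_nonzero_transpose: "transpose X \<in> ternary_nonzero \<longleftrightarrow> X \<in> ternary_nonzero"
  unfolding ternary_nonzero_def by (auto simp: transpose_def row_def column_def)

lemma C_P_transpose: "C_P (transpose X) = C_D X"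
  by (simp add: C_P_def C_D_def)

lemma C_D_transpose: "C_D (transpose X) = C_P X"
  by (simp add: C_P_def C_D_def)

lemma C_P_ternary:
  assumes "\<And>i j. X $ i $ j \<in> {-1, 0, 1}"
  shows "C_P X = real (\<Sum>i\<in>UNIV. (l0_norm (row i X))\<^sup>2)"
  unfolding C_P_def using assms
  by (simp add: norm_square_ternary row_def) (simp add: power2_eq_square)

lemma C_D_ternary:
  assumes "\<And>i j. X $ i $ j \<in> {-1, 0, 1}"
  shows "C_D X = real (\<Sum>j\<in>UNIV. (l0_norm (column j X))\<^sup>2)"
  unfolding C_D_def using assms
  by (simp add: norm_square_ternary column_def) (simp add: power2_eq_square)

subsection \<open>Bounds for the two sums\<close>

lemma C_P_le_upper_U:
  fixes X :: "real ^ 'n ^ 'd"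
  assumes X: "X \<in> ternary_nonzero" and n: "2 \<le> CARD('n)"
  shows "C_P X \<le> upper_U (int (mat_l0_norm X)) (int CARD('n)) (int CARD('d))"
proof -
  \<comment> \<open>No row is zero, so one entry per row is forced. The rest of each row count
    ranges from 0 to n - 1, and the truncated subtraction is exact.\<close>
  define y where "y i = l0_norm (row i X) - 1" for i
  have pos: "0 < l0_norm (row i X)" for i
    using X by (auto simp: ternary_nonzero_def l0_norm_pos)
  have y: "l0_norm (row i X) = y i + 1" for i
    using pos[of i] by (simp add: y_def)
  have yle: "y i \<le> CARD('n) - 1" for i
    unfolding y_def using l0_norm_le[of "row i X"] by simp
  define T where "T = (\<Sum>i\<in>UNIV. y i)"
  have total: "mat_l0_norm X = T + CARD('d)"
    by (simp add: mat_l0_norm_rows y T_def sum.distrib del: One_nat_def)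
  have "C_P X = real (\<Sum>i\<in>UNIV. (y i + 1)\<^sup>2)"
    using X by (subst C_P_ternary) (auto simp: ternary_nonzero_def y)
  also have "(\<Sum>i\<in>UNIV. (y i + 1)\<^sup>2) = (\<Sum>i\<in>UNIV. (y i)\<^sup>2) + 2 * T + CARD('d)"
    by (simp add: T_def power2_sum sum.distrib sum_distrib_left del: One_nat_def)
  also have "real \<dots> \<le> real (extremal_squares (CARD('n) - 1) T + 2 * T + CARD('d))"
    using sum_squares_le_extremal[of "UNIV :: 'd set" "CARD('n) - 1" y] n yle
    by (simp add: T_def del: of_nat_add of_nat_sum)
  also have "\<dots> = upper_U (int (mat_l0_norm X)) (int CARD('n)) (int CARD('d))"
    using upper_U_eq[OF n, of T "CARD('d)"] by (simp add: total)
  finally show ?thesis .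
qed

lemma lower_L_le_C_D:
  fixes X :: "real ^ 'n ^ 'd"
  assumes X: "X \<in> ternary_nonzero"
  shows "lower_L (int (mat_l0_norm X)) (int CARD('n)) \<le> C_D X"
proof -
  define c where "c j = int (l0_norm (column j X))" for j
  define q where "q = int (mat_l0_norm X) div int CARD('n)"
  \<comment> \<open>No integer lies strictly between q and q + 1. The balance identity thus gives a
    lower bound for every integer q; the q chosen here yields \<open>lower_L\<close>.\<close>
  have "0 \<le> (c j - q) * (c j - (q + 1))" for j
    by (cases "c j \<le> q") (auto intro: mult_nonpos_nonpos)
  then have "0 \<le> (\<Sum>j\<in>UNIV. (c j - q) * (c j - (q + 1)))"
    by (rule sum_nonneg)
  moreover have "int (mat_l0_norm X) = (\<Sum>j\<in>UNIV. c j)"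
    by (simp add: mat_l0_norm_columns c_def)
  ultimately have "(2 * q + 1) * int (mat_l0_norm X) - int CARD('n) * (q * (q + 1))
      \<le> (\<Sum>j\<in>UNIV. (c j)\<^sup>2)"
    using sum_squares_balanced[of c UNIV q] by simp
  moreover have "C_D X = real_of_int (\<Sum>j\<in>UNIV. (c j)\<^sup>2)"
    using X by (subst C_D_ternary) (auto simp: ternary_nonzero_def c_def)
  ultimately show ?thesis
    by (subst lower_L_eq) (simp_all only: q_def of_int_le_iff of_nat_0_less_iff zero_less_card_finite)
qed

lemma mat_l0_norm_pos:
  fixes X :: "real ^ 'n ^ 'd"
  assumes "X \<in> ternary_nonzero"
  shows "0 < mat_l0_norm X"
  unfolding mat_l0_norm_rows using assms
  by (intro sum_pos) (auto simp: ternary_nonzero_def l0_norm_pos)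

text \<open>Numerator and denominator are bounded separately. This loses nothing, because
  \<open>extremal_matrix\<close> attains both bounds at once.\<close>

lemma C_P_div_C_D_le:
  fixes X :: "real ^ 'n ^ 'd"
  assumes "X \<in> ternary_nonzero" and "2 \<le> CARD('n)"
  shows "C_P X / C_D X \<le> ratio_R (int (mat_l0_norm X)) (int CARD('d)) (int CARD('n))"
proof -
  have "0 \<le> C_P X"
    by (simp add: C_P_def sum_nonneg)
  moreover have "0 < lower_L (int (mat_l0_norm X)) (int CARD('n))"
    using mat_l0_norm_pos[OF assms(1)] by (intro lower_L_pos) auto
  ultimately show ?thesis
    unfolding ratio_R_def
    by (intro frac_le order.trans[OF _ C_P_le_upper_U[OF assms]] C_P_le_upper_U lower_L_le_C_D assms)
qed

subsection \<open>Cyclic filling\<close>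

text \<open>Each of the a div n complete blocks of n consecutive numbers contributes one t, and the
  incomplete last block at most one.\<close>

lemma card_residue_class_below:
  assumes "0 < n" and "k < n"
  shows "card {t. t < a \<and> t mod n = k} \<in> {a div n, a div n + 1}"
proof -
  let ?A = "{t. t < a \<and> t mod n = k}"
  have fin: "finite ?A"
    by simp
  have "(\<lambda>b. n * b + k) ` {..<a div n} \<subseteq> ?A"
  proof
    fix t assume "t \<in> (\<lambda>b. n * b + k) ` {..<a div n}"
    then obtain b where b: "b < a div n" "t = n * b + k"
      by auto
    have "n * b + k < n * (b + 1)"
      using assms by simp
    also have "\<dots> \<le> n * (a div n)"
      using b by (intro mult_le_mono2) simp
    also have "\<dots> \<le> a"
      by simp
    finally show "t \<in> ?A"
      using b assms by simp
  qed
  then have "card ((\<lambda>b. n * b + k) ` {..<a div n}) \<le> card ?A"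
    by (rule card_mono[OF fin])
  moreover have "inj_on (\<lambda>b. n * b + k) {..<a div n}"
    using assms by (auto simp: inj_on_def)
  ultimately have lower: "a div n \<le> card ?A"
    by (simp add: card_image)
  \<comment> \<open>Within one residue class the block number t div n determines t, and it is at
    most a div n.\<close>
  have "inj_on (\<lambda>t. t div n) ?A"
    by (rule inj_onI) (metis (mono_tags, lifting) mem_Collect_eq mult_div_mod_eq)
  then have "card ?A = card ((\<lambda>t. t div n) ` ?A)"
    by (simp add: card_image)
  also have "\<dots> \<le> card {..a div n}"
    by (rule card_mono) (auto intro: div_le_mono)
  finally show ?thesis
    using lower by auto
qed

text \<open>Two elements of the interval differ by less than n. In the filling this puts the entries
  of one row into different columns.\<close>

lemma inj_on_mod_interval:
  fixes S :: nat
  assumes "r \<le> n"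
  shows "inj_on (\<lambda>t. t mod n) {S..<S + r}"
proof -
  have eq: "s = t" if "s \<le> t" "s mod n = t mod n" "S \<le> s" "t < S + r" for s t
  proof -
    have "n dvd t - s"
      using that by (metis mod_eq_dvd_iff_nat)
    moreover have "t - s < n"
      using that assms by simp
    ultimately have "\<not> 0 < t - s"
      using nat_dvd_not_less by blast
    then show ?thesis
      using that by simp
  qed
  show ?thesis
  proof (rule inj_onI)
    fix s t assume "s \<in> {S..<S + r}" "t \<in> {S..<S + r}" "s mod n = t mod n"
    then show "s = t"
      using eq[of s t] eq[of t s] by (cases "s \<le> t") auto
  qed
qed

text \<open>The entries are numbered 0, 1, 2, ... row by row, and number t goes to the column j with
  g j = t mod n. The column counts then depend only on the total of the row counts, not on how it is
  split.\<close>

lemma cyclic_filling: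
  fixes g :: "'b \<Rightarrow> nat" and r :: "'a \<Rightarrow> nat"
  assumes g: "bij_betw g UNIV {..<n}" and "0 < n" and "finite I" and r: "\<And>i. r i \<le> n"
  shows "\<exists>A :: 'a \<Rightarrow> 'b set. (\<forall>i\<in>I. card (A i) = r i) \<and>
    (\<forall>j. card {i \<in> I. j \<in> A i} = card {t. t < (\<Sum>i\<in>I. r i) \<and> t mod n = g j})"
  using \<open>finite I\<close>
proof (induction I rule: finite_induct)
  case empty
  show ?case by simp
next
  case (insert x I)
  then obtain A :: "'a \<Rightarrow> 'b set" where A: "\<And>i. i \<in> I \<Longrightarrow> card (A i) = r i"
      "\<And>j. card {i \<in> I. j \<in> A i} = card {t. t < (\<Sum>i\<in>I. r i) \<and> t mod n = g j}"
    by blast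
  \<comment> \<open>The rows in I use up the first S numbers. The new row x takes the next r x of
    them, the block W, and B collects the columns that they reach.\<close>
  define S where "S = (\<Sum>i\<in>I. r i)"
  define W where "W = {S..<S + r x}"
  define B where "B = {j. \<exists>t\<in>W. t mod n = g j}"
  have inj: "inj_on (\<lambda>t. t mod n) W"
    unfolding W_def by (rule inj_on_mod_interval[OF r])
  have ginj: "inj g" and grange: "range g = {..<n}"
    using g by (auto simp: bij_betw_def)
  \<comment> \<open>As g is injective and the residues on W are distinct, this equality gives B the
    same size as W.\<close>
  have "g ` B = (\<lambda>t. t mod n) ` W"
  proof
    show "(\<lambda>t. t mod n) ` W \<subseteq> g ` B"
    proof
      fix k assume "k \<in> (\<lambda>t. t mod n) ` W"
      then obtain t where t: "t \<in> W" "k = t mod n" by auto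
      then have "k \<in> range g" using \<open>0 < n\<close> grange by simp
      then show "k \<in> g ` B" using t by (auto simp: B_def)
    qed
    show "g ` B \<subseteq> (\<lambda>t. t mod n) ` W"
    proof
      fix k assume "k \<in> g ` B"
      then obtain t where "t \<in> W" "t mod n = k" by (auto simp: B_def)
      then show "k \<in> (\<lambda>t. t mod n) ` W" by blast
    qed
  qed
  then have "card B = card W"
    using ginj inj by (metis card_image inj_on_subset subset_UNIV)
  then have rowx: "card B = r x"
    by (simp add: W_def)
  let ?A' = "A(x := B)"
  have "card {i \<in> insert x I. j \<in> ?A' i} = card {t. t < S + r x \<and> t mod n = g j}" for j
  proof -
    let ?V = "{t \<in> W. t mod n = g j}"
    \<comment> \<open>Residues are distinct on W, so the new row adds at most one entry to each
      column.\<close>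
    have "card ?V = (if j \<in> B then 1 else 0)"
    proof (cases "j \<in> B")
      case True
      then obtain t where t: "t \<in> W" "t mod n = g j"
        by (auto simp: B_def)
      have "?V = {t}"
        using t inj by (auto simp: inj_on_def)
      then show ?thesis using True by simp
    next
      case False
      then have "?V = {}" by (auto simp: B_def)
      then show ?thesis using False by (simp only: card.empty if_False)
    qed
    moreover have "card {t. t < S + r x \<and> t mod n = g j}
        = card {t. t < S \<and> t mod n = g j} + card ?V"
    proof -
      have "t < S + r x \<longleftrightarrow> t < S \<or> t \<in> W" for t
        by (auto simp: W_def)
      then have "{t. t < S + r x \<and> t mod n = g j} = {t. t < S \<and> t mod n = g j} \<union> ?V"
        by blast
      moreover have "\<not> t < S" if "t \<in> W" for t
        using that by (simp add: W_def)
      then have "{t. t < S \<and> t mod n = g j} \<inter> ?V = {}" "finite ?V"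
        by (blast, simp add: W_def)
      moreover have "finite {t. t < S \<and> t mod n = g j}"
        by simp
      ultimately show ?thesis
        by (simp only: card_Un_disjoint)
    qed
    moreover have "{i \<in> insert x I. j \<in> ?A' i}
        = (if j \<in> B then insert x {i \<in> I. j \<in> A i} else {i \<in> I. j \<in> A i})"
      using insert.hyps by auto
    ultimately show ?thesis
      using insert.hyps A(2)[of j] by (simp add: S_def)
  qed
  moreover have "\<forall>i\<in>insert x I. card (?A' i) = r i"
    using A(1) rowx by auto
  ultimately show ?case
    using insert.hyps by (intro exI[of _ ?A']) (simp add: S_def add.commute)
qed

section \<open>A matrix attaining both extremes\<close>

lemma extremal_matrix:
  fixes \<alpha> :: int
  assumes n: "2 \<le> CARD('n)"
    and \<alpha>: "int CARD('d) \<le> \<alpha>" "int CARD('n) \<le> \<alpha>" "\<alpha> \<le> int CARD('d) * int CARD('n)"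
  shows "\<exists>X \<in> (ternary_nonzero :: (real ^ 'n ^ 'd) set). int (mat_l0_norm X) = \<alpha> \<and>
    C_P X = upper_U \<alpha> (int CARD('n)) (int CARD('d)) \<and> C_D X = lower_L \<alpha> (int CARD('n))"
proof -
  define m where "m = CARD('n) - 1"
  define T where "T = nat \<alpha> - CARD('d)"
  have m: "0 < m" "CARD('n) = m + 1"
    using n by (auto simp: m_def)
  have T: "\<alpha> = int T + int CARD('d)"
    using \<alpha> by (simp add: T_def)
  \<comment> \<open>The bound \<alpha> \<le> d * n says that T, the total beyond one forced entry
    per row, fits into d values of at most n - 1.\<close>
  have "int T + int CARD('d) \<le> int (CARD('d) * m) + int CARD('d)"
    using \<alpha>(3) m(2) by (simp add: T algebra_simps)
  then have "T \<le> card (UNIV :: 'd set) * m"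
    by linarith
  then obtain y :: "'d \<Rightarrow> nat" where y: "\<And>i. y i \<le> m" "(\<Sum>i\<in>UNIV. y i) = T"
      "(\<Sum>i\<in>UNIV. (y i)\<^sup>2) = extremal_squares m T"
    using sum_squares_extremal_attained[of "UNIV :: 'd set" m T] m by auto
  define r where "r i = y i + 1" for i
  have r: "r i \<le> CARD('n)" for i
    using y(1)[of i] m by (simp add: r_def)
  have sum_r: "(\<Sum>i\<in>UNIV. r i) = nat \<alpha>"
    using y(2) \<alpha> by (simp add: r_def sum.distrib T del: One_nat_def)
  obtain g :: "'n \<Rightarrow> nat" where g: "bij_betw g UNIV {..<CARD('n)}"
    using finite_same_card_bij[of "UNIV :: 'n set" "{..<CARD('n)}"] by auto
  have "\<exists>A :: 'd \<Rightarrow> 'n set. (\<forall>i\<in>UNIV. card (A i) = r i) \<and>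
      (\<forall>j. card {i \<in> UNIV. j \<in> A i} = card {t. t < nat \<alpha> \<and> t mod CARD('n) = g j})"
    unfolding sum_r[symmetric] by (rule cyclic_filling[OF g]) (simp_all add: r)
  then obtain A :: "'d \<Rightarrow> 'n set" where A: "\<And>i. card (A i) = r i"
      "\<And>j. card {i. j \<in> A i} = card {t. t < nat \<alpha> \<and> t mod CARD('n) = g j}"
    unfolding ball_UNIV by (simp only: UNIV_I simp_thms) blast
  define X :: "real ^ 'n ^ 'd" where "X = (\<chi> i j. if j \<in> A i then 1 else 0)"
  have entries: "X $ i $ j \<in> {-1, 0, 1}" for i j
    by (simp add: X_def)
  have rows: "l0_norm (row i X) = r i" for i
    by (simp add: l0_norm_def row_def X_def A)
  have total: "mat_l0_norm X = nat \<alpha>"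
    by (simp add: mat_l0_norm_rows rows sum_r)
  define q where "q = nat \<alpha> div CARD('n)"
  have cols: "l0_norm (column j X) \<in> {q, q + 1}" for j
  proof -
    have "g j < CARD('n)"
      using g by (auto simp: bij_betw_def)
    then show ?thesis
      using card_residue_class_below[of "CARD('n)" "g j" "nat \<alpha>"]
      by (simp add: l0_norm_def column_def X_def A q_def)
  qed
  \<comment> \<open>Here n \<le> \<alpha> enters: every column count is at least q, so no column is
    zero. Rows are nonzero because r i = y i + 1.\<close>
  have "1 \<le> q"
    using div_le_mono[of "CARD('n)" "nat \<alpha>" "CARD('n)"] \<alpha> by (simp add: q_def)
  then have "column j X \<noteq> 0" for j
    using cols[of j] by (auto simp: l0_norm_def)
  moreover have "row i X \<noteq> 0" for i
    using rows[of i] by (auto simp: r_def l0_norm_def)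
  ultimately have X: "X \<in> ternary_nonzero"
    using entries by (simp add: ternary_nonzero_def)
  have "(\<Sum>i\<in>UNIV. (r i)\<^sup>2) = extremal_squares m T + 2 * T + CARD('d)"
    by (simp add: r_def power2_sum sum.distrib y(3) flip: y(2) sum_distrib_left del: One_nat_def)
  then have "C_P X = upper_U \<alpha> (int CARD('n)) (int CARD('d))"
    using upper_U_eq[OF n, of T "CARD('d)"]
    by (simp add: C_P_ternary[OF entries] rows T m_def)
  moreover have "C_D X = lower_L \<alpha> (int CARD('n))"
  proof -
    define c where "c j = int (l0_norm (column j X))" for j
    \<comment> \<open>Such counts make every term of the balance identity vanish, which turns the
      lower bound into an equality.\<close>
    have "c j = int q \<or> c j = int q + 1" for j
      using cols[of j] by (auto simp: c_def)
    then have "(c j - int q) * (c j - (int q + 1)) = 0" for j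
      by (metis diff_self mult_eq_0_iff)
    then have "(\<Sum>j\<in>UNIV. (c j - int q) * (c j - (int q + 1))) = 0"
      by (simp only: sum.neutral_const)
    moreover have "(\<Sum>j\<in>UNIV. c j) = \<alpha>"
      using total \<alpha> by (simp add: mat_l0_norm_columns c_def flip: of_nat_sum)
    ultimately have "(\<Sum>j\<in>UNIV. (c j)\<^sup>2)
        = (2 * int q + 1) * \<alpha> - int CARD('n) * (int q * (int q + 1))"
      using sum_squares_balanced[of c UNIV "int q"] by simp
    moreover have "int q = \<alpha> div int CARD('n)"
      using \<alpha> by (simp add: q_def zdiv_int)
    moreover have "C_D X = real_of_int (\<Sum>j\<in>UNIV. (c j)\<^sup>2)"
      by (simp add: C_D_ternary[OF entries] c_def)
    ultimately show ?thesis
      by (simp only: lower_L_eq of_nat_0_less_iff zero_less_card_finite)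
  qed
  ultimately show ?thesis
    using X total \<alpha> by (intro bexI[of _ X]) auto
qed

section \<open>The ratio bounds and their tightness\<close>

theorem theorem4:
  fixes d n :: int
  assumes "d = int CARD('d::finite)" and "n = int CARD('n::finite)"
    and "d \<ge> 2" and "n \<ge> 2"
  shows "(\<forall>X \<in> (ternary_nonzero :: (real ^ 'n ^ 'd) set).
            1 / ratio_R (int (mat_l0_norm X)) n d \<le> C_P X / C_D X \<and>
            C_P X / C_D X \<le> ratio_R (int (mat_l0_norm X)) d n) \<and>
         (\<forall>\<alpha>::int. max d n \<le> \<alpha> \<and> \<alpha> \<le> d * n \<longrightarrow>
            (\<exists>X \<in> (ternary_nonzero :: (real ^ 'n ^ 'd) set).
               int (mat_l0_norm X) = \<alpha> \<and> 1 / ratio_R \<alpha> n d = C_P X / C_D X) \<and>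
            (\<exists>X \<in> (ternary_nonzero :: (real ^ 'n ^ 'd) set).
               int (mat_l0_norm X) = \<alpha> \<and> C_P X / C_D X = ratio_R \<alpha> d n))"
proof (intro conjI ballI allI impI)
  have card: "2 \<le> CARD('d)" "2 \<le> CARD('n)"
    using assms by auto
  fix X :: "real ^ 'n ^ 'd" assume X: "X \<in> ternary_nonzero"
  show "C_P X / C_D X \<le> ratio_R (int (mat_l0_norm X)) d n"
    using C_P_div_C_D_le[OF X card(2)] assms by simp
  \<comment> \<open>The lower bound is the reciprocal of the upper bound for the transpose.\<close>
  have X': "transpose X \<in> ternary_nonzero"
    using X by (simp add: ternary_nonzero_transpose)
  have "C_D X / C_P X \<le> ratio_R (int (mat_l0_norm X)) n d"
    using C_P_div_C_D_le[OF X' card(1)] assms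
    by (simp add: C_P_transpose C_D_transpose mat_l0_norm_transpose)
  \<comment> \<open>Taking reciprocals reverses the inequality only between positive numbers. Both
    sums are at least a positive value of \<open>lower_L\<close>.\<close>
  moreover have "0 < C_D X / C_P X"
  proof -
    have "0 < lower_L (int (mat_l0_norm X)) (int CARD('n))"
      "0 < lower_L (int (mat_l0_norm X)) (int CARD('d))"
      using mat_l0_norm_pos[OF X] by (auto intro: lower_L_pos)
    then show ?thesis
      using lower_L_le_C_D[OF X] lower_L_le_C_D[OF X']
      by (simp add: C_D_transpose mat_l0_norm_transpose)
  qed
  ultimately have "1 / ratio_R (int (mat_l0_norm X)) n d \<le> 1 / (C_D X / C_P X)"
    by (intro divide_left_mono mult_pos_pos) auto
  then show "1 / ratio_R (int (mat_l0_norm X)) n d \<le> C_P X / C_D X"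
    by simp
next
  fix \<alpha> :: int assume \<alpha>: "max d n \<le> \<alpha> \<and> \<alpha> \<le> d * n"
  obtain X :: "real ^ 'n ^ 'd" where "X \<in> ternary_nonzero" "int (mat_l0_norm X) = \<alpha>"
      "C_P X = upper_U \<alpha> n d" "C_D X = lower_L \<alpha> n"
    using extremal_matrix[where 'n = 'n and 'd = 'd, of \<alpha>] \<alpha> assms by auto
  then show "\<exists>X \<in> (ternary_nonzero :: (real ^ 'n ^ 'd) set).
      int (mat_l0_norm X) = \<alpha> \<and> C_P X / C_D X = ratio_R \<alpha> d n"
    by (auto simp: ratio_R_def)
  \<comment> \<open>For the lower bound the extremal matrix is built with the dimensions swapped;
    transposing it back exchanges \<open>C_P\<close> and \<open>C_D\<close>.\<close>
  obtain Y :: "real ^ 'd ^ 'n" where "Y \<in> ternary_nonzero" "int (mat_l0_norm Y) = \<alpha>"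
      "C_P Y = upper_U \<alpha> d n" "C_D Y = lower_L \<alpha> d"
    using extremal_matrix[where 'n = 'd and 'd = 'n, of \<alpha>] \<alpha> assms by (auto simp: mult.commute)
  then show "\<exists>X \<in> (ternary_nonzero :: (real ^ 'n ^ 'd) set).
      int (mat_l0_norm X) = \<alpha> \<and> 1 / ratio_R \<alpha> n d = C_P X / C_D X"
    by (intro bexI[of _ "transpose Y"])
      (simp_all add: ratio_R_def C_P_transpose C_D_transpose mat_l0_norm_transpose
        ternary_nonzero_transpose)
qed

end
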